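(* Let $u:\mathbb{Z}^d\to\mathbb{R}$, $u\not\equiv0$, satisfy $|u(k)|\le Ce^{-\alpha\|k\|_1}$ for all $k\in\mathbb{Z}^d$ with constants $C,\alpha>0$, and let $c_u\neq0$ and $I_0\in\mathbb{N}_0^d$ be as in the context. Let further $l>0$ and define $$R_l:=\max\Bigl\{2l+\frac2\alpha\ln\frac{2\cdot3^d\,C}{|c_u|(1-e^{-\alpha/2})},\ \frac{8(d+\|I_0\|_1)^2}{\alpha^2}\Bigr\}.$$ Then for all $x\in\mathfrak{C}_l$ $$\frac{2}{c_u}\sum_{k\in\mathfrak{C}_{R_l}}k^{I_0}\,u(x-k)\ge1.$$
   Context: $\mathfrak{C}_R=[-R,R]^d\cap\mathbb{Z}^d$ for $R>0$. Multi-index notation: $z^I=z_1^{i_1}\cdots z_d^{i_d}$ (with $0^0=1$), $D_z^I=\partial_{z_1}^{i_1}\cdots\partial_{z_d}^{i_d}$; for $I,J\in\mathbb{N}_0^d$, $J<I$ means $J\le I$ componentwise and $\|J\|_1<\|I\|_1$. $\mathbf{1}=(1,\dots,1)$. The generating function $F(z)=\sum_{k\in\mathbb{Z}^d}u(-k)z^k$ is holomorphic on $\{z\in\mathbb{C}^d:|z_j-1|<\delta\ \forall j\}$ for $\delta\in(0,1-e^{-\alpha})$ and not identically zero. $I_0\in\mathbb{N}_0^d$ is a (not necessarily unique) multi-index with $(D_z^{I_0}F)(\mathbf{1})=c_u\ne0$ and $(D_z^IF)(\mathbf{1})=0$ for all $I<I_0$; such $I_0$ exists. *)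

theory Defs
  imports "HOL-Analysis.Analysis"
begin

text \<open>
  The lattice \<open>\<int>\<^sup>d\<close> is \<open>int ^ 'd\<close> with \<open>d = CARD('d)\<close>, and multi-indices are elements of
  \<open>nat ^ 'd\<close>. The linear order on \<open>'d\<close> identifies the index set with \<open>1 < \<dots> < d\<close>; it serves only
  to fix the order in which partial derivatives are composed.
\<close>

definition l1_norm :: "int ^ 'd \<Rightarrow> real" where
  "l1_norm k = (\<Sum>j\<in>UNIV. \<bar>real_of_int (k $ j)\<bar>)"

definition lattice_cube :: "real \<Rightarrow> (int ^ 'd) set" where
  "lattice_cube R = {k. \<forall>j. - R \<le> real_of_int (k $ j) \<and> real_of_int (k $ j) \<le> R}"

definition mi_size :: "nat ^ 'd \<Rightarrow> nat" where
  "mi_size I = (\<Sum>j\<in>UNIV. I $ j)"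

definition mi_less :: "nat ^ 'd \<Rightarrow> nat ^ 'd \<Rightarrow> bool" where
  "mi_less J I \<longleftrightarrow> (\<forall>j. J $ j \<le> I $ j) \<and> mi_size J < mi_size I"

definition mi_power :: "'a::comm_monoid_mult ^ 'd \<Rightarrow> nat ^ 'd \<Rightarrow> 'a" where
  "mi_power z I = (\<Prod>j\<in>UNIV. (z $ j) ^ (I $ j))"

definition mi_powi :: "complex ^ 'd \<Rightarrow> int ^ 'd \<Rightarrow> complex" where
  "mi_powi z k = (\<Prod>j\<in>UNIV. (z $ j) powi (k $ j))"

definition partial_deriv :: "'d \<Rightarrow> (complex ^ 'd \<Rightarrow> complex) \<Rightarrow> complex ^ 'd \<Rightarrow> complex" where
  "partial_deriv j f z = deriv (\<lambda>w. f (\<chi> i. if i = j then w else z $ i)) (z $ j)"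

definition mi_deriv ::
  "nat ^ 'd::{finite,linorder} \<Rightarrow> (complex ^ 'd::{finite,linorder} \<Rightarrow> complex)
    \<Rightarrow> complex ^ 'd::{finite,linorder} \<Rightarrow> complex" where
  "mi_deriv I f = foldr (\<lambda>j. partial_deriv j ^^ (I $ j)) (sorted_list_of_set UNIV) f"

text \<open>
  The sum is the unconditional sum over the whole lattice; where the family is not summable
  \<^const>\<open>infsum\<close> is \<open>0\<close>. For exponentially decaying \<open>u\<close> it is absolutely summable near
  \<open>(1, \<dots>, 1)\<close>, which is all that the derivatives there depend on.
\<close>

definition gen_fun :: "(int ^ 'd \<Rightarrow> real) \<Rightarrow> complex ^ 'd \<Rightarrow> complex" where
  "gen_fun u z = (\<Sum>\<^sub>\<infinity>k\<in>UNIV. complex_of_real (u (- k)) * mi_powi z k)"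

definition cutoff_radius :: "real \<Rightarrow> real \<Rightarrow> complex \<Rightarrow> nat ^ 'd \<Rightarrow> real \<Rightarrow> real" where
  "cutoff_radius C \<alpha> c I l =
     max (2 * l + 2 / \<alpha> * ln (2 * 3 ^ CARD('d) * C / (cmod c * (1 - exp (- \<alpha> / 2)))))
         (8 * (real CARD('d) + real (mi_size I))\<^sup>2 / \<alpha>\<^sup>2)"

end

theory Submission
  imports Defs "HOL-Complex_Analysis.Cauchy_Integral_Formula"
begin

text \<open>
  Differentiating the Laurent series of \<open>F\<close> termwise, \<open>(D\<^sup>p F)(\<one>)\<close> is the factorial moment
  \<open>\<Sum>k. u (- k) * (\<Prod>j. k\<^sub>j (k\<^sub>j - 1) \<dots> (k\<^sub>j - p\<^sub>j + 1))\<close>. Expanding \<open>(x + k)\<^sup>I\<close> in falling factorials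
  of \<open>k\<close>, only the top coefficient, which is \<open>1\<close>, meets a nonvanishing moment, so the sum of
  \<open>k\<^sup>I u (x - k)\<close> over the whole lattice is \<open>c\<close> for every \<open>x\<close>. The part of it outside the cube of
  radius \<open>R\<close> is at most \<open>|c| / 2\<close>: on the shell \<open>\<parallel>k\<parallel>\<^sub>\<infinity> = n\<close> there are at most \<open>(3 n)\<^sup>d\<close> points, and half
  of the exponential decay absorbs the power of \<open>n\<close>.
\<close>

subsection \<open>Summable families on the integer lattice\<close>

text \<open>The terms are nonnegative, so it is enough to bound finite sums. A finite set of points
  lies in a box with the same finite side \<open>B\<close> in every coordinate; over the box the sum
  of products factors into one-dimensional sums, each at most the full
  \<open>infsum\<close>.\<close>

lemma summable_on_prod_vec:
  fixes h :: "'d::finite \<Rightarrow> 'a \<Rightarrow> real"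
  assumes "\<And>j. h j summable_on UNIV" "\<And>j a. h j a \<ge> 0"
  shows "(\<lambda>k::'a^'d. \<Prod>j\<in>UNIV. h j (k $ j)) summable_on UNIV"
proof (rule nonneg_bdd_above_summable_on)
  show "bdd_above (sum (\<lambda>k::'a^'d. \<Prod>j\<in>UNIV. h j (k $ j)) ` {F. F \<subseteq> UNIV \<and> finite F})"
  proof (rule bdd_aboveI2)
    fix F :: "('a ^ 'd) set"
    assume "F \<in> {F. F \<subseteq> UNIV \<and> finite F}"
    hence F: "finite F" by simp
    define B where "B = (\<Union>k\<in>F. range (vec_nth k))"
    have B: "finite B" using F by (auto simp: B_def)
    have "(\<Sum>k\<in>F. \<Prod>j\<in>UNIV. h j (k $ j)) = (\<Sum>g\<in>vec_nth ` F. \<Prod>j\<in>UNIV. h j (g j))"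
      by (subst sum.reindex) (auto simp: inj_on_def vec_nth_inject)
    also have "\<dots> \<le> (\<Sum>g\<in>PiE UNIV (\<lambda>_. B). \<Prod>j\<in>UNIV. h j (g j))"
      by (rule sum_mono2) (use B assms in \<open>auto simp: B_def intro!: finite_PiE prod_nonneg\<close>)
    also have "\<dots> = (\<Prod>j\<in>UNIV. \<Sum>a\<in>B. h j a)"
      by (rule prod_sum_PiE[symmetric]) (use B in auto)
    also have "\<dots> \<le> (\<Prod>j\<in>UNIV. infsum (h j) UNIV)"
      by (intro prod_mono conjI sum_nonneg finite_sum_le_infsum) (use B assms in auto)
    finally show "(\<Sum>k\<in>F. \<Prod>j\<in>UNIV. h j (k $ j)) \<le> (\<Prod>j\<in>UNIV. infsum (h j) UNIV)" .
  qed
qed (use assms in \<open>auto intro: prod_nonneg\<close>)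

lemma power_le_fact_mult_exp:
  fixes y :: real
  assumes "y \<ge> 0"
  shows "y ^ n \<le> fact n * exp y"
proof -
  have "(\<Sum>k\<in>{n}. y ^ k /\<^sub>R fact k) \<le> exp y"
    unfolding exp_def by (rule sum_le_suminf) (use assms summable_exp_generic[of y] in auto)
  thus ?thesis by (simp add: field_simps)
qed

lemma summable_on_int_of_nat:
  fixes f :: "nat \<Rightarrow> real"
  assumes "f summable_on UNIV"
  shows "(\<lambda>k::int. f (nat \<bar>k\<bar>)) summable_on UNIV"
proof -
  have "(\<lambda>k::int. f (nat \<bar>k\<bar>)) summable_on {0..}"
  proof -
    have "bij_betw int UNIV {0..}"
      by (rule bij_betwI[of _ _ _ nat]) auto
    thus ?thesis
      using summable_on_reindex_bij_betw[of int UNIV "{0..}" "\<lambda>k. f (nat \<bar>k\<bar>)"] assms by simp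
  qed
  moreover have "(\<lambda>k::int. f (nat \<bar>k\<bar>)) summable_on {..<0}"
  proof -
    have "(\<lambda>n. f (Suc n)) summable_on UNIV"
      using summable_on_reindex[of Suc UNIV f] summable_on_subset[OF assms, of "range Suc"] by (simp add: o_def)
    \<comment> \<open>The shift by one starts this half at -1, so that 0 is counted in the first
      half only.\<close>
    moreover have "bij_betw (\<lambda>n. - int (Suc n)) UNIV {..<0}"
      by (rule bij_betwI[of _ _ _ "\<lambda>k. nat (- k) - 1"]) auto
    ultimately show ?thesis
      using summable_on_reindex_bij_betw[of "\<lambda>n. - int (Suc n)" UNIV "{..<0}" "\<lambda>k::int. f (nat \<bar>k\<bar>)"]
      by (simp add: nat_add_distrib)
  qed
  moreover have "(UNIV :: int set) = {0..} \<union> {..<0}" by auto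
  ultimately show ?thesis by (metis summable_on_union)
qed

lemma summable_on_power_exp_int:
  fixes \<beta> a :: real
  assumes "\<beta> > 0" "a \<ge> 0"
  shows "(\<lambda>k::int. (\<bar>real_of_int k\<bar> + a) ^ q * exp (- \<beta> * \<bar>real_of_int k\<bar>)) summable_on UNIV"
proof -
  \<comment> \<open>\<open>power_le_fact_mult_exp\<close> at \<open>\<beta> / 2 * (x + a)\<close>
    trades the power for a factor \<open>exp (\<beta> / 2 * x)\<close>. \<open>K\<close> collects
    what does not depend on \<open>x\<close>, and the remaining half of the decay is
    geometric.\<close>
  define K where "K = (2 / \<beta>) ^ q * fact q * exp (\<beta> / 2 * a)"
  have bound: "(x + a) ^ q * exp (- \<beta> * x) \<le> K * exp (- \<beta> / 2) ^ n"
    if x: "x = real n" for x n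
  proof -
    have "(\<beta> / 2 * (x + a)) ^ q \<le> fact q * exp (\<beta> / 2 * (x + a))"
      by (rule power_le_fact_mult_exp) (use assms x in simp)
    hence *: "(2 / \<beta>) ^ q * (\<beta> / 2 * (x + a)) ^ q \<le> (2 / \<beta>) ^ q * (fact q * exp (\<beta> / 2 * (x + a)))"
      by (rule mult_left_mono) (use assms in auto)
    have "(x + a) ^ q \<le> (2 / \<beta>) ^ q * (fact q * exp (\<beta> / 2 * (x + a)))"
    proof -
      have "(2 / \<beta>) * (\<beta> / 2 * (x + a)) = x + a" using assms by simp
      thus ?thesis using * by (metis power_mult_distrib)
    qed
    hence "(x + a) ^ q * exp (- \<beta> * x) \<le> (2 / \<beta>) ^ q * (fact q * exp (\<beta> / 2 * (x + a))) * exp (- \<beta> * x)"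
      by (rule mult_right_mono) simp
    also have "\<dots> = K * (exp (\<beta> / 2 * x) * exp (- \<beta> * x))"
      by (simp add: K_def distrib_left exp_add)
    also have "exp (\<beta> / 2 * x) * exp (- \<beta> * x) = exp (- \<beta> / 2) ^ n"
      by (simp add: x flip: exp_add exp_of_nat_mult)
    finally show ?thesis .
  qed
  have "summable (\<lambda>n. K * exp (- \<beta> / 2) ^ n)"
    by (intro summable_mult summable_geometric) (use assms in simp)
  hence "(\<lambda>n. K * exp (- \<beta> / 2) ^ n) summable_on UNIV"
    by (intro norm_summable_imp_summable_on) (use assms in \<open>auto simp: K_def abs_mult\<close>)
  hence *: "(\<lambda>k::int. K * exp (- \<beta> / 2) ^ nat \<bar>k\<bar>) summable_on UNIV"
    by (rule summable_on_int_of_nat)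
  show ?thesis
  proof (rule abs_summable_summable, rule Infinite_Sum.abs_summable_on_comparison_test'[OF *])
    fix k :: int
    have "norm ((\<bar>real_of_int k\<bar> + a) ^ q * exp (- \<beta> * \<bar>real_of_int k\<bar>)) =
        (\<bar>real_of_int k\<bar> + a) ^ q * exp (- \<beta> * \<bar>real_of_int k\<bar>)"
      using assms by simp
    also have "\<dots> \<le> K * exp (- \<beta> / 2) ^ nat \<bar>k\<bar>"
      by (rule bound) simp
    finally show "norm ((\<bar>real_of_int k\<bar> + a) ^ q * exp (- \<beta> * \<bar>real_of_int k\<bar>)) \<le>
        K * exp (- \<beta> / 2) ^ nat \<bar>k\<bar>" .
  qed
qed

subsection \<open>Falling factorials\<close>

text \<open>The coefficient that appears when w^k is differentiated \<open>p\<close> times in w. The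
  argument is an integer because Laurent exponents may be negative.\<close>

definition ffact :: "int \<Rightarrow> nat \<Rightarrow> int" where
  "ffact k p = (\<Prod>i<p. k - int i)"

lemma ffact_0 [simp]: "ffact k 0 = 1"
  by (simp add: ffact_def)

lemma ffact_Suc: "ffact k (Suc p) = ffact k p * (k - int p)"
  by (simp add: ffact_def)

lemma abs_ffact_le: "\<bar>real_of_int (ffact k p)\<bar> \<le> (\<bar>real_of_int k\<bar> + real p) ^ p"
proof -
  have "\<bar>real_of_int (ffact k p)\<bar> = (\<Prod>i<p. \<bar>real_of_int k - real i\<bar>)"
    by (simp add: ffact_def abs_prod)
  also have "\<dots> \<le> (\<Prod>i<p. \<bar>real_of_int k\<bar> + real p)"
    by (rule prod_mono) auto
  finally show ?thesis by simp
qed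

lemma has_sum_finite_sum:
  fixes f :: "'i \<Rightarrow> 'a \<Rightarrow> 'b::topological_comm_monoid_add"
  assumes "\<And>i. i \<in> I \<Longrightarrow> (f i has_sum s i) A"
  shows "((\<lambda>x. \<Sum>i\<in>I. f i x) has_sum (\<Sum>i\<in>I. s i)) A"
  using assms
proof (induction I rule: infinite_finite_induct)
  case (insert i I)
  thus ?case by (simp add: has_sum_add)
qed simp_all

text \<open>Induction on \<open>n\<close>: in x + k = (x + p) + (k - p) the first part keeps
  \<open>ffact k p\<close> and the second raises it to \<open>ffact k (Suc p)\<close>. The
  coefficients may depend on \<open>x\<close> but not on \<open>k\<close>, and the top one stays
  1.\<close>

lemma shifted_power_ffact:
  fixes x :: int
  shows "\<exists>c. c n = 1 \<and> (\<forall>k. (x + k) ^ n = (\<Sum>p\<le>n. c p * ffact k p))"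
proof (induction n)
  case 0
  show ?case by (intro exI[of _ "\<lambda>_. 1"]) auto
next
  case (Suc n)
  then obtain c where c: "c n = 1" "\<And>k. (x + k) ^ n = (\<Sum>p\<le>n. c p * ffact k p)" by blast
  \<comment> \<open>The guards stand for zero coefficients at the indices -1 and n + 1, so that one
    formula serves the whole range up to \<open>Suc n\<close>.\<close>
  define c' where "c' p = (if p = 0 then 0 else c (p - 1)) + (if p \<le> n then (x + int p) * c p else 0)" for p
  have "(x + k) ^ Suc n = (\<Sum>p\<le>Suc n. c' p * ffact k p)" for k
  proof -
    have "(x + k) ^ Suc n = (\<Sum>p\<le>n. c p * ((x + k) * ffact k p))"
      by (simp add: c(2) sum_distrib_left mult_ac)
    also have "\<dots> = (\<Sum>p\<le>n. c p * ffact k (Suc p)) + (\<Sum>p\<le>n. (x + int p) * c p * ffact k p)"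
      unfolding sum.distrib[symmetric] by (rule sum.cong) (auto simp: ffact_Suc algebra_simps)
    also have "(\<Sum>p\<le>n. c p * ffact k (Suc p)) = (\<Sum>p\<le>Suc n. (if p = 0 then 0 else c (p - 1)) * ffact k p)"
      by (subst sum.atMost_Suc_shift) simp
    also have "(\<Sum>p\<le>n. (x + int p) * c p * ffact k p) =
        (\<Sum>p\<le>Suc n. (if p \<le> n then (x + int p) * c p else 0) * ffact k p)"
      by simp
    also have "(\<Sum>p\<le>Suc n. (if p = 0 then 0 else c (p - 1)) * ffact k p) + \<dots> = (\<Sum>p\<le>Suc n. c' p * ffact k p)"
      by (simp only: sum.distrib[symmetric] c'_def distrib_right)
    finally show ?thesis .
  qed
  moreover have "c' (Suc n) = 1" by (simp add: c'_def c)
  ultimately show ?case by blast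
qed

subsection \<open>Termwise differentiation of Laurent series\<close>

text \<open>Since \<open>exp \<beta> + exp (- \<beta>) \<ge> 2\<close>, the disc around 1 lies in
  the annulus between the radii \<open>exp (- \<beta>)\<close> and \<open>exp \<beta>\<close>. There
  the logarithm of the modulus is at most \<open>\<beta>\<close> in absolute value, which handles
  exponents of both signs at once.\<close>

lemma norm_powi_le:
  fixes z :: complex
  assumes "\<beta> > 0" "norm (z - 1) \<le> 1 - exp (- \<beta>)"
  shows "norm (z powi n) \<le> exp (\<beta> * \<bar>real_of_int n\<bar>)"
proof -
  have *: "exp (- \<beta>) \<le> norm z" "norm z \<le> 2 - exp (- \<beta>)"
    using assms norm_triangle_ineq[of "z - 1" 1] norm_triangle_ineq2[of 1 "1 - z"]
    by (auto simp: norm_minus_commute)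
  have z: "norm z > 0" using * exp_gt_zero[of "- \<beta>"] by linarith
  have "(exp \<beta> - 1)\<^sup>2 \<ge> 0" by simp
  hence "2 - exp (- \<beta>) \<le> exp \<beta>"
    by (simp add: exp_minus field_simps power2_eq_square)
  hence "norm z \<le> exp \<beta>" using * by linarith
  hence "ln (norm z) \<le> \<beta>" "- \<beta> \<le> ln (norm z)"
    using * z ln_mono[of "norm z" "exp \<beta>"] by (auto simp: ln_ge_iff)
  hence "\<bar>ln (norm z)\<bar> \<le> \<beta>" by linarith
  hence "ln (norm z) * real_of_int n \<le> \<beta> * \<bar>real_of_int n\<bar>"
    by (metis abs_ge_self abs_ge_zero abs_mult mult_right_mono order_trans)
  hence "exp (ln (norm z) * real_of_int n) \<le> exp (\<beta> * \<bar>real_of_int n\<bar>)" by simp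
  also have "exp (ln (norm z) * real_of_int n) = norm z powi n"
    using z by (simp add: powr_def mult.commute flip: powr_real_of_int')
  finally show ?thesis by (simp add: norm_power_int)
qed

text \<open>The mixed derivative of order \<open>p\<close> of the Laurent monomial with coefficient
  \<open>a k\<close>. With \<open>p\<close> a function, one more derivative in the variable
  \<open>j\<close> is a function update.\<close>

definition lterm :: "(int ^ 'd \<Rightarrow> complex) \<Rightarrow> ('d \<Rightarrow> nat) \<Rightarrow> complex ^ 'd \<Rightarrow> int ^ 'd \<Rightarrow> complex" where
  "lterm a p z k = a k * (\<Prod>j\<in>UNIV. of_int (ffact (k $ j) (p j)) * (z $ j) powi (k $ j - int (p j)))"

lemma lterm_ones: "lterm a p (\<chi> j. 1) k = a k * of_int (\<Prod>j\<in>UNIV. ffact (k $ j) (p j))"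
  by (simp add: lterm_def)

text \<open>Only the factor of index \<open>j\<close> varies, and differentiating it brings down
  \<open>k $ j - p j\<close>, the next factor of the falling factorial. The exponent may be
  negative, hence \<open>w \<noteq> 0\<close>.\<close>

lemma has_field_derivative_lterm:
  fixes z :: "complex ^ 'd::finite"
  assumes "w \<noteq> 0"
  shows "((\<lambda>w. lterm a p (\<chi> i. if i = j then w else z $ i) k) has_field_derivative
           lterm a (p(j := Suc (p j))) (\<chi> i. if i = j then w else z $ i) k) (at w)"
proof -
  define P where "P = (\<Prod>i\<in>UNIV - {j}. of_int (ffact (k $ i) (p i)) * (z $ i) powi (k $ i - int (p i)))"
  have split: "lterm a q (\<chi> i. if i = j then w else z $ i) k =
      a k * (of_int (ffact (k $ j) (q j)) * w powi (k $ j - int (q j)) * P)"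
    if "\<And>i. i \<noteq> j \<Longrightarrow> q i = p i" for q w
    unfolding lterm_def P_def by (subst prod.remove[of UNIV j]) (use that in \<open>auto intro!: prod.cong\<close>)
  have "(\<lambda>w. lterm a p (\<chi> i. if i = j then w else z $ i) k) =
      (\<lambda>w. a k * (of_int (ffact (k $ j) (p j)) * w powi (k $ j - int (p j)) * P))"
    by (rule ext, rule split) simp
  moreover have "((\<lambda>w. a k * (of_int (ffact (k $ j) (p j)) * w powi (k $ j - int (p j)) * P)) has_field_derivative
      a k * (of_int (ffact (k $ j) (p j)) * (of_int (k $ j - int (p j)) * w powi (k $ j - int (p j) - 1) * 1) * P)) (at w)"
    by (intro DERIV_cmult DERIV_cmult_right DERIV_power_int DERIV_ident) (use assms in auto)
  moreover have "a k * (of_int (ffact (k $ j) (p j)) * (of_int (k $ j - int (p j)) * w powi (k $ j - int (p j) - 1) * 1) * P) =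
      lterm a (p(j := Suc (p j))) (\<chi> i. if i = j then w else z $ i) k"
    by (subst split) (simp_all add: ffact_Suc diff_diff_eq add.commute mult.assoc)
  ultimately show ?thesis by simp
qed

text \<open>Varying one coordinate is continuous, so \<open>f\<close> and \<open>g\<close> agree
  along it near \<open>z $ j\<close>. This lets derivatives be iterated when a formula is known only
  on an open set.\<close>

lemma partial_deriv_cong:
  fixes f g :: "complex ^ 'd::finite \<Rightarrow> complex"
  assumes "open S" "z \<in> S" "\<And>y. y \<in> S \<Longrightarrow> f y = g y"
  shows "partial_deriv j f z = partial_deriv j g z"
proof -
  have "continuous_on UNIV (\<lambda>w. (\<chi> i. if i = j then w else z $ i) :: complex ^ 'd)"
  proof (rule continuous_on_vec_lambda)
    show "continuous_on UNIV (\<lambda>w. if i = j then w else z $ i)" for i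
      by (cases "i = j") auto
  qed
  hence "open ((\<lambda>w. (\<chi> i. if i = j then w else z $ i) :: complex ^ 'd) -` S)"
    using assms(1) open_vimage by blast
  moreover have "z $ j \<in> (\<lambda>w. (\<chi> i. if i = j then w else z $ i)) -` S"
  proof -
    have "(\<chi> i. if i = j then z $ j else z $ i) = z" by (simp add: vec_eq_iff)
    thus ?thesis using assms(2) by simp
  qed
  ultimately have "\<forall>\<^sub>F w in nhds (z $ j). f (\<chi> i. if i = j then w else z $ i) = g (\<chi> i. if i = j then w else z $ i)"
    unfolding eventually_nhds
    by (intro exI[of _ "(\<lambda>w. (\<chi> i. if i = j then w else z $ i)) -` S"] conjI ballI assms(3)) auto
  thus ?thesis unfolding partial_deriv_def by (rule deriv_cong_ev) simp
qed

section \<open>Laurent series with exponentially decaying coefficients on a polydisc\<close>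

locale decaying_family =
  fixes a :: "int ^ 'd::{finite,linorder} \<Rightarrow> complex" and C \<alpha> :: real
  assumes \<alpha>_pos: "\<alpha> > 0" and decay: "norm (a k) \<le> C * exp (- \<alpha> * l1_norm k)"
begin

text \<open>With \<open>\<alpha> / 2\<close> in place of \<open>\<alpha>\<close>, the monomials on
  the polydisc use up only half of the decay of the coefficients.\<close>

definition \<delta> :: real where "\<delta> = 1 - exp (- (\<alpha> / 2))"

definition polydisc :: "(complex ^ 'd::{finite,linorder}) set" where
  "polydisc = {z. \<forall>j. z $ j \<in> ball 1 \<delta>}"

definition laurent :: "('d::{finite,linorder} \<Rightarrow> nat) \<Rightarrow> complex ^ 'd::{finite,linorder} \<Rightarrow> complex" where
  "laurent p z = (\<Sum>\<^sub>\<infinity>k\<in>UNIV. lterm a p z k)"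

lemma \<delta>_pos: "\<delta> > 0" and \<delta>_less_1: "\<delta> < 1"
  using \<alpha>_pos by (auto simp: \<delta>_def)

lemma C_nonneg: "C \<ge> 0"
proof -
  have "0 \<le> C * exp (- \<alpha> * l1_norm (0 :: int ^ 'd::{finite,linorder}))" by (rule order_trans[OF norm_ge_zero decay])
  thus ?thesis by (simp add: l1_norm_def)
qed

text \<open>The bound is uniform in \<open>z\<close>, as the Weierstrass test requires, and is a
  product over the coordinates, so its summability is one-dimensional.\<close>

lemma lterm_majorant:
  "\<exists>M. M summable_on UNIV \<and> (\<forall>z\<in>polydisc. \<forall>k. norm (lterm a p z k) \<le> M k)"
proof (intro exI conjI ballI allI)
  \<comment> \<open>The factor \<open>exp (\<alpha> / 2 * real (p j))\<close> pays for the shifted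
    exponent, through |n - p| \<le> |n| + p.\<close>
  define h where "h j n = exp (\<alpha> / 2 * real (p j)) *
      ((\<bar>real_of_int n\<bar> + real (p j)) ^ p j * exp (- (\<alpha> / 2) * \<bar>real_of_int n\<bar>))" for j and n :: int
  show "(\<lambda>k::int ^ 'd::{finite,linorder}. C * (\<Prod>j\<in>UNIV. h j (k $ j))) summable_on UNIV"
    unfolding h_def using \<alpha>_pos
    by (intro summable_on_cmult_right summable_on_prod_vec summable_on_power_exp_int) auto
  fix z k assume z: "z \<in> polydisc"
  have "norm (lterm a p z k) = norm (a k) *
      (\<Prod>j\<in>UNIV. \<bar>real_of_int (ffact (k $ j) (p j))\<bar> * norm ((z $ j) powi (k $ j - int (p j))))"
    by (simp add: lterm_def norm_mult flip: prod_norm)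
  also have "\<dots> \<le> (C * exp (- \<alpha> * l1_norm k)) *
      (\<Prod>j\<in>UNIV. (\<bar>real_of_int (k $ j)\<bar> + real (p j)) ^ p j *
         exp (\<alpha> / 2 * (\<bar>real_of_int (k $ j)\<bar> + real (p j))))"
  proof (intro mult_mono prod_mono conjI decay abs_ffact_le prod_nonneg mult_nonneg_nonneg)
    fix j
    have "norm ((z $ j) powi (k $ j - int (p j))) \<le> exp (\<alpha> / 2 * \<bar>real_of_int (k $ j - int (p j))\<bar>)"
      by (rule norm_powi_le)
         (use z \<alpha>_pos in \<open>auto simp: polydisc_def \<delta>_def dist_norm norm_minus_commute less_imp_le\<close>)
    also have "\<dots> \<le> exp (\<alpha> / 2 * (\<bar>real_of_int (k $ j)\<bar> + real (p j)))"
      using \<alpha>_pos by (simp add: mult_left_mono)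
    finally show "norm ((z $ j) powi (k $ j - int (p j))) \<le> \<dots>" .
  qed (use C_nonneg in auto)
  also have "exp (- \<alpha> * l1_norm k) = (\<Prod>j\<in>UNIV. exp (- \<alpha> * \<bar>real_of_int (k $ j)\<bar>))"
    by (simp add: l1_norm_def sum_distrib_left exp_sum flip: sum_negf)
  also have "C * \<dots> * (\<Prod>j\<in>UNIV. (\<bar>real_of_int (k $ j)\<bar> + real (p j)) ^ p j *
         exp (\<alpha> / 2 * (\<bar>real_of_int (k $ j)\<bar> + real (p j)))) = C * (\<Prod>j\<in>UNIV. h j (k $ j))"
    unfolding mult.assoc prod.distrib[symmetric]
  proof (intro arg_cong2[of _ _ _ _ "(*)"] refl prod.cong)
    fix j
    define t where "t = \<bar>real_of_int (k $ j)\<bar>"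
    have "exp (- \<alpha> * t) * exp (\<alpha> / 2 * (t + real (p j))) = exp (\<alpha> / 2 * real (p j)) * exp (- (\<alpha> / 2) * t)"
      by (simp add: field_simps flip: exp_add)
    hence "exp (- \<alpha> * t) * ((t + real (p j)) ^ p j * exp (\<alpha> / 2 * (t + real (p j)))) =
        (t + real (p j)) ^ p j * (exp (\<alpha> / 2 * real (p j)) * exp (- (\<alpha> / 2) * t))"
      by (subst mult.left_commute) (rule arg_cong)
    also have "\<dots> = exp (\<alpha> / 2 * real (p j)) * ((t + real (p j)) ^ p j * exp (- (\<alpha> / 2) * t))"
      by (rule mult.left_commute)
    finally show "exp (- \<alpha> * \<bar>real_of_int (k $ j)\<bar>) * ((\<bar>real_of_int (k $ j)\<bar> + real (p j)) ^ p j *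
        exp (\<alpha> / 2 * (\<bar>real_of_int (k $ j)\<bar> + real (p j)))) = h j (k $ j)"
      unfolding h_def t_def .
  qed
  finally show "norm (lterm a p z k) \<le> C * (\<Prod>j\<in>UNIV. h j (k $ j))" .
qed

lemma lterm_has_sum:
  assumes "z \<in> polydisc"
  shows "(lterm a p z has_sum laurent p z) UNIV"
proof -
  obtain M where M: "M summable_on UNIV" "\<And>z k. z \<in> polydisc \<Longrightarrow> norm (lterm a p z k) \<le> M k"
    using lterm_majorant[of p] by blast
  have "(\<lambda>k. norm (lterm a p z k)) summable_on UNIV"
    by (rule Infinite_Sum.abs_summable_on_comparison_test'[OF M(1)]) (rule M(2)[OF assms])
  thus ?thesis
    unfolding laurent_def by (rule has_sum_infsum[OF abs_summable_summable])
qed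

text \<open>Along the coordinate \<open>j\<close> the finite partial sums are holomorphic and
  converge uniformly on a closed disc. Hence their derivatives, which are partial sums of the next
  \<open>lterm\<close> family, converge to the derivative of the limit.\<close>

lemma partial_deriv_laurent:
  assumes z: "z \<in> polydisc"
  shows "partial_deriv j (laurent p) z = laurent (p(j := Suc (p j))) z"
proof -
  define sub where "sub w = (\<chi> i. if i = j then w else z $ i)" for w
  define p' where "p' = p(j := Suc (p j))"
  obtain M where M: "M summable_on UNIV" "\<And>z k. z \<in> polydisc \<Longrightarrow> norm (lterm a p z k) \<le> M k"
    using lterm_majorant[of p] by blast
  have "z $ j \<in> ball 1 \<delta>" using z by (simp add: polydisc_def)
  then obtain r where r: "r > 0" "cball (z $ j) r \<subseteq> ball 1 \<delta>"
    using open_contains_cball open_ball by blast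
  have sub: "sub w \<in> polydisc" if "w \<in> cball (z $ j) r" for w
    using that r z by (auto simp: polydisc_def sub_def)
  \<comment> \<open>\<open>\<delta> < 1\<close> keeps the disc away from 0, where negative powers
    are singular.\<close>
  have nz: "w \<noteq> 0" if "w \<in> cball (z $ j) r" for w
    using that r \<delta>_less_1 by (auto simp: subset_iff)
  have ulim: "uniform_limit (cball (z $ j) r) (\<lambda>A w. \<Sum>k\<in>A. lterm a p (sub w) k)
      (\<lambda>w. laurent p (sub w)) (finite_subsets_at_top UNIV)"
    unfolding laurent_def by (rule Weierstrass_m_test_general[OF M(2) M(1)]) (rule sub)
  have der: "((\<lambda>w. \<Sum>k\<in>A. lterm a p (sub w) k) has_field_derivative (\<Sum>k\<in>A. lterm a p' (sub w) k)) (at w)"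
    if "w \<in> cball (z $ j) r" for w A
    unfolding sub_def p'_def by (intro DERIV_sum has_field_derivative_lterm nz that)
  have "\<forall>\<^sub>F A in finite_subsets_at_top UNIV. continuous_on (cball (z $ j) r) (\<lambda>w. \<Sum>k\<in>A. lterm a p (sub w) k) \<and>
      (\<forall>w\<in>ball (z $ j) r. ((\<lambda>w. \<Sum>k\<in>A. lterm a p (sub w) k) has_field_derivative
         (\<Sum>k\<in>A. lterm a p' (sub w) k)) (at w))"
    by (intro always_eventually allI conjI ballI der DERIV_continuous_on[OF has_field_derivative_at_within, OF der])
       auto
  from has_complex_derivative_uniform_limit[OF this ulim finite_subsets_at_top_neq_bot r(1)]
  obtain g' where g': "((\<lambda>w. laurent p (sub w)) has_field_derivative g' (z $ j)) (at (z $ j))"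
    "((\<lambda>A. \<Sum>k\<in>A. lterm a p' (sub (z $ j)) k) \<longlongrightarrow> g' (z $ j)) (finite_subsets_at_top UNIV)"
    using r(1) by (metis centre_in_ball)
  have "sub (z $ j) = z" by (simp add: sub_def vec_eq_iff)
  \<comment> \<open>The limit of the differentiated partial sums at the centre is by definition an
    unconditional sum, so uniqueness identifies it.\<close>
  hence "(lterm a p' z has_sum g' (z $ j)) UNIV"
    using g'(2) by (simp add: has_sum_def)
  hence "g' (z $ j) = laurent p' z" using lterm_has_sum[OF z, of p'] has_sum_unique by blast
  thus ?thesis
    using DERIV_imp_deriv[OF g'(1)] by (simp add: partial_deriv_def sub_def p'_def)
qed

lemma open_polydisc: "open polydisc"
proof -
  have "polydisc = (\<Inter>j\<in>UNIV. (\<lambda>z. z $ j) -` ball 1 \<delta>)" by (auto simp: polydisc_def)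
  also have "open \<dots>"
    by (intro open_INT finite_UNIV ballI open_vimage open_ball continuous_on_component continuous_on_id) simp
  finally show ?thesis .
qed

text \<open>Agreement of \<open>f\<close> with the series is asked on the polydisc only, because
  \<open>f\<close> will itself be an iterated derivative known just there.\<close>

lemma partial_deriv_funpow_laurent:
  assumes "\<And>y. y \<in> polydisc \<Longrightarrow> f y = laurent p y" "z \<in> polydisc"
  shows "(partial_deriv j ^^ n) f z = laurent (p(j := p j + n)) z"
  using assms(2)
proof (induction n arbitrary: z)
  case 0
  thus ?case using assms(1) by simp
next
  case (Suc n)
  have "(partial_deriv j ^^ Suc n) f z = partial_deriv j (laurent (p(j := p j + n))) z"
    unfolding funpow.simps o_apply by (rule partial_deriv_cong[OF open_polydisc Suc.prems Suc.IH])
  also have "\<dots> = laurent (p(j := p j + Suc n)) z"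
    unfolding partial_deriv_laurent[OF Suc.prems] by simp
  finally show ?case .
qed

lemma mi_deriv_laurent:
  assumes "z \<in> polydisc"
  shows "mi_deriv I (laurent (\<lambda>_. 0)) z = laurent (\<lambda>j. I $ j) z"
proof -
  \<comment> \<open>Generalised to any distinct list: its variables are differentiated to full
    order, the others not at all. Distinctness makes the order in each new variable start from
    0.\<close>
  have "foldr (\<lambda>j. partial_deriv j ^^ (I $ j)) xs (laurent (\<lambda>_. 0)) z =
      laurent (\<lambda>j. if j \<in> set xs then I $ j else 0) z" if "distinct xs" "z \<in> polydisc" for xs z
    using that
  proof (induction xs arbitrary: z)
    case (Cons x xs)
    have "(partial_deriv x ^^ (I $ x)) (foldr (\<lambda>j. partial_deriv j ^^ (I $ j)) xs (laurent (\<lambda>_. 0))) z =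
        laurent ((\<lambda>j. if j \<in> set xs then I $ j else 0)
          (x := (if x \<in> set xs then I $ x else 0) + I $ x)) z"
      by (rule partial_deriv_funpow_laurent) (use Cons in auto)
    also have "(\<lambda>j. if j \<in> set xs then I $ j else 0)(x := (if x \<in> set xs then I $ x else 0) + I $ x) =
        (\<lambda>j. if j \<in> set (x # xs) then I $ j else 0)"
      using Cons.prems by auto
    finally show ?case by simp
  qed simp
  from this[OF distinct_sorted_list_of_set assms] show ?thesis
    by (simp add: mi_deriv_def)
qed

section \<open>Moments of the coefficients\<close>

lemma ones_in_polydisc: "(\<chi> j. 1) \<in> polydisc"
  by (simp add: polydisc_def \<delta>_pos)

lemma factorial_moment_has_sum:
  "((\<lambda>k. a k * of_int (\<Prod>j\<in>UNIV. ffact (k $ j) (I $ j))) has_sum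
      mi_deriv I (laurent (\<lambda>_. 0)) (\<chi> j. 1)) UNIV"
  using lterm_has_sum[OF ones_in_polydisc, of "\<lambda>j. I $ j"]
  by (simp add: lterm_ones[abs_def] mi_deriv_laurent ones_in_polydisc)

text \<open>The expansion involves only multi-indices componentwise below \<open>I\<close>. All of
  them except \<open>I\<close> itself have vanishing moments, and \<open>I\<close> has coefficient
  1, so the value does not depend on \<open>x\<close>.\<close>

lemma shifted_moment_has_sum:
  assumes "mi_deriv I (laurent (\<lambda>_. 0)) (\<chi> j. 1) = c"
    and "\<And>J. mi_less J I \<Longrightarrow> mi_deriv J (laurent (\<lambda>_. 0)) (\<chi> j. 1) = 0"
  shows "((\<lambda>k. a k * of_int (mi_power (x + k) I)) has_sum c) UNIV"
proof -
  have "\<forall>j. \<exists>e. e (I $ j) = 1 \<and> (\<forall>k. (x $ j + k) ^ (I $ j) = (\<Sum>p\<le>I $ j. e p * ffact k p))"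
    using shifted_power_ffact by blast
  then obtain e where e: "\<And>j. e j (I $ j) = 1"
    "\<And>j k. (x $ j + k) ^ (I $ j) = (\<Sum>p\<le>I $ j. e j p * ffact k p)"
    by metis
  define P where "P = PiE UNIV (\<lambda>j. {..I $ j})"
  have P: "finite P" by (auto simp: P_def intro: finite_PiE)
  have expand: "mi_power (x + k) I = (\<Sum>p\<in>P. (\<Prod>j\<in>UNIV. e j (p j)) * (\<Prod>j\<in>UNIV. ffact (k $ j) (p j)))" for k
  proof -
    have "mi_power (x + k) I = (\<Prod>j\<in>UNIV. \<Sum>p\<le>I $ j. e j p * ffact (k $ j) p)"
      by (simp add: mi_power_def e(2))
    also have "\<dots> = (\<Sum>p\<in>P. \<Prod>j\<in>UNIV. e j (p j) * ffact (k $ j) (p j))"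
      unfolding P_def by (rule prod_sum_PiE) auto
    finally show ?thesis by (simp add: prod.distrib)
  qed
  define m where "m p = mi_deriv (\<chi> j. p j) (laurent (\<lambda>_. 0)) (\<chi> j. 1)" for p
  have "((\<lambda>k. \<Sum>p\<in>P. of_int (\<Prod>j\<in>UNIV. e j (p j)) * (a k * of_int (\<Prod>j\<in>UNIV. ffact (k $ j) (p j)))) has_sum
      (\<Sum>p\<in>P. of_int (\<Prod>j\<in>UNIV. e j (p j)) * m p)) UNIV"
    unfolding m_def
    by (intro has_sum_finite_sum has_sum_cmult_right)
       (use P factorial_moment_has_sum[of "\<chi> j. p j" for p] in auto)
  also have "(\<Sum>p\<in>P. of_int (\<Prod>j\<in>UNIV. e j (p j)) * m p) = (\<Sum>p\<in>P. if p = (\<lambda>j. I $ j) then c else 0)"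
  proof (rule sum.cong[OF refl])
    fix p assume p: "p \<in> P"
    show "of_int (\<Prod>j\<in>UNIV. e j (p j)) * m p = (if p = (\<lambda>j. I $ j) then c else 0)"
    proof (cases "p = (\<lambda>j. I $ j)")
      case True
      thus ?thesis by (simp add: e m_def assms)
    next
      case False
      \<comment> \<open>One strict coordinate, the others being at most those of \<open>I\<close>,
        makes the size strictly smaller, which is what \<open>mi_less\<close> asks for.\<close>
      then obtain j where "p j \<noteq> I $ j" by blast
      moreover have le: "p j \<le> I $ j" for j using p by (auto simp: P_def PiE_iff)
      ultimately have "p j < I $ j" using le_neq_implies_less by blast
      hence "(\<Sum>j\<in>UNIV. p j) < (\<Sum>j\<in>UNIV. I $ j)"
        by (intro sum_strict_mono_ex1) (auto intro: le)
      hence "mi_less (\<chi> j. p j) I" using le by (simp add: mi_less_def mi_size_def)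
      thus ?thesis using False by (simp add: m_def assms)
    qed
  qed
  also have "\<dots> = c" using P by (simp add: sum.delta P_def PiE_iff)
  finally show ?thesis
    by (simp add: expand sum_distrib_left mult_ac)
qed

end

subsection \<open>The tail outside a cube\<close>

text \<open>With y = sqrt (2 x) one has x = y^2 / 2 \<le> exp y, hence x^m \<le> exp (m y). The
  exponent is at most \<alpha> x / 2 = \<alpha> y^2 / 4 once 4 m \<le> \<alpha> y; squared, this is
  the hypothesis with its constant 8.\<close>

lemma power_le_exp_half:
  fixes x \<alpha> :: real
  assumes "\<alpha> > 0" "8 * (real m)\<^sup>2 / \<alpha>\<^sup>2 \<le> x"
  shows "x ^ m \<le> exp (\<alpha> / 2 * x)"
proof -
  have x: "x \<ge> 0" by (rule order_trans[OF _ assms(2)]) simp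
  define y where "y = sqrt (2 * x)"
  have y: "y \<ge> 0" "y\<^sup>2 = 2 * x" using x by (auto simp: y_def)
  have "(4 * real m)\<^sup>2 \<le> (\<alpha> * y)\<^sup>2"
    using assms by (simp add: power_mult_distrib y field_simps)
  hence "4 * real m \<le> \<alpha> * y"
    by (rule power2_le_imp_le) (use assms y in simp)
  hence "4 * real m * y \<le> \<alpha> * y * y" using y by (intro mult_right_mono)
  also have "\<alpha> * y * y = 2 * (\<alpha> * x)" using y(2) by (simp add: power2_eq_square)
  finally have my: "real m * y \<le> \<alpha> / 2 * x" by (simp add: mult.commute)
  have "x \<le> exp y" using exp_lower_Taylor_quadratic[OF y(1)] y by simp
  hence "x ^ m \<le> exp y ^ m" using x by (intro power_mono)
  also have "\<dots> = exp (real m * y)" by (simp add: exp_of_nat_mult)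
  also have "\<dots> \<le> exp (\<alpha> / 2 * x)" using my by simp
  finally show ?thesis .
qed

lemma sum_geometric_tail_le:
  fixes q :: real
  assumes "finite B" "B \<subseteq> {n..}" "0 \<le> q" "q < 1"
  shows "(\<Sum>i\<in>B. q ^ i) \<le> q ^ n / (1 - q)"
proof -
  have "(\<Sum>i\<in>B. q ^ i) = (\<Sum>i\<in>B. q ^ n * q ^ (i - n))"
    using assms(2) by (intro sum.cong) (auto simp flip: power_add)
  also have "\<dots> = q ^ n * (\<Sum>i\<in>(\<lambda>i. i - n) ` B. q ^ i)"
    by (subst sum.reindex) (use assms(2) in \<open>auto simp: sum_distrib_left inj_on_diff_nat subset_iff\<close>)
  also have "\<dots> \<le> q ^ n * (\<Sum>i. q ^ i)"
    by (intro mult_left_mono sum_le_suminf) (use assms in auto)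
  finally show ?thesis using assms by (simp add: suminf_geometric)
qed

section \<open>Sup-norm shells, cubes and the tail estimate\<close>

definition linf_norm :: "int ^ 'd \<Rightarrow> nat" where
  "linf_norm k = Max (range (\<lambda>j. nat \<bar>k $ j\<bar>))"

lemma abs_le_linf_norm: "\<bar>k $ j\<bar> \<le> int (linf_norm k)"
proof -
  have "nat \<bar>k $ j\<bar> \<le> linf_norm k" unfolding linf_norm_def by (rule Max_ge) auto
  thus ?thesis by linarith
qed

lemma linf_norm_attained: obtains j where "\<bar>k $ j\<bar> = int (linf_norm k)"
proof -
  have "linf_norm k \<in> range (\<lambda>j. nat \<bar>k $ j\<bar>)" unfolding linf_norm_def by (rule Max_in) auto
  thus ?thesis using that by auto
qed

lemma linf_norm_gt_iff: "linf_norm k > R \<longleftrightarrow> k \<notin> lattice_cube R" for R :: real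
proof
  assume "linf_norm k > R"
  moreover obtain j where "\<bar>k $ j\<bar> = int (linf_norm k)" using linf_norm_attained .
  ultimately have "\<bar>real_of_int (k $ j)\<bar> > R" by (metis of_int_abs of_int_of_nat_eq)
  thus "k \<notin> lattice_cube R" by (auto simp: lattice_cube_def abs_if split: if_splits intro!: exI[of _ j])
next
  assume "k \<notin> lattice_cube R"
  then obtain j where "\<not> (- R \<le> real_of_int (k $ j) \<and> real_of_int (k $ j) \<le> R)" by (auto simp: lattice_cube_def)
  hence "\<bar>real_of_int (k $ j)\<bar> > R" by linarith
  also have "\<bar>real_of_int (k $ j)\<bar> \<le> real (linf_norm k)"
    using abs_le_linf_norm[of k j] by linarith
  finally show "linf_norm k > R" .
qed

lemma finite_card_linf_norm_le:
  shows "finite {k::int ^ 'd::finite. linf_norm k \<le> n}"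
    and "card {k::int ^ 'd::finite. linf_norm k \<le> n} \<le> (2 * n + 1) ^ CARD('d)"
proof -
  let ?P = "PiE (UNIV::'d set) (\<lambda>_. {- int n..int n})"
  have P: "finite ?P" by (auto intro: finite_PiE)
  have sub: "{k::int ^ 'd. linf_norm k \<le> n} \<subseteq> vec_lambda ` ?P"
  proof
    fix k :: "int ^ 'd" assume k: "k \<in> {k. linf_norm k \<le> n}"
    have "vec_nth k \<in> ?P"
    proof (rule PiE_I)
      show "k $ j \<in> {- int n..int n}" for j using k abs_le_linf_norm[of k j] by auto
    qed auto
    moreover have "k = vec_lambda (vec_nth k)" by simp
    ultimately show "k \<in> vec_lambda ` ?P" by blast
  qed
  show "finite {k::int ^ 'd. linf_norm k \<le> n}"
    using finite_subset[OF sub] P by blast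
  have "card {k::int ^ 'd. linf_norm k \<le> n} \<le> card ?P"
    using card_mono[OF finite_imageI[OF P] sub] card_image_le[OF P, of vec_lambda] by linarith
  also have "card ?P = (2 * n + 1) ^ CARD('d)"
    by (subst card_PiE) (simp_all add: nat_add_distrib nat_mult_distrib)
  finally show "card {k::int ^ 'd. linf_norm k \<le> n} \<le> (2 * n + 1) ^ CARD('d)" .
qed

lemma finite_lattice_cube: "finite (lattice_cube R :: (int ^ 'd::finite) set)"
proof -
  have "lattice_cube R \<subseteq> {k::int ^ 'd. linf_norm k \<le> nat \<lfloor>R\<rfloor>}"
  proof
    fix k :: "int ^ 'd" assume "k \<in> lattice_cube R"
    hence "real (linf_norm k) \<le> R" using linf_norm_gt_iff[of R k] by linarith
    thus "k \<in> {k. linf_norm k \<le> nat \<lfloor>R\<rfloor>}" by simp linarith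
  qed
  thus ?thesis using finite_card_linf_norm_le(1) finite_subset by blast
qed

lemma abs_mi_power_le: "\<bar>mi_power k I\<bar> \<le> int (linf_norm k) ^ mi_size I"
proof -
  have "\<bar>mi_power k I\<bar> = (\<Prod>j\<in>UNIV. \<bar>k $ j\<bar> ^ (I $ j))"
    by (simp add: mi_power_def abs_prod power_abs)
  also have "\<dots> \<le> (\<Prod>j\<in>UNIV. int (linf_norm k) ^ (I $ j))"
    by (intro prod_mono conjI power_mono abs_le_linf_norm) auto
  finally show ?thesis by (simp add: mi_size_def power_sum)
qed

text \<open>A coordinate where |k| is largest already gives the bound, since x moves it by at most
  \<open>l\<close>.\<close>

lemma l1_norm_diff_ge:
  assumes "x \<in> lattice_cube l"
  shows "l1_norm (x - k) \<ge> real (linf_norm k) - l"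
proof -
  obtain j where j: "\<bar>k $ j\<bar> = int (linf_norm k)" using linf_norm_attained .
  have "\<bar>real_of_int ((x - k) $ j)\<bar> \<le> l1_norm (x - k)"
    unfolding l1_norm_def by (rule member_le_sum) auto
  moreover have "- l \<le> real_of_int (x $ j)" "real_of_int (x $ j) \<le> l"
    using assms by (auto simp: lattice_cube_def)
  moreover have "\<bar>real_of_int (k $ j)\<bar> = real (linf_norm k)" using j by linarith
  ultimately show ?thesis by simp
qed

text \<open>Group by shells. A term on shell n is at most C exp (\<alpha> l) n^|I| exp (- \<alpha>
  n); after the count of points, \<open>power_le_exp_half\<close> with m = d + |I| leaves a
  geometric series of ratio \<open>exp (- \<alpha> / 2)\<close>. Finite sets \<open>A\<close>
  suffice to control the infinite tail later.\<close>

lemma sum_outside_cube_le: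
  fixes u :: "int ^ 'd::finite \<Rightarrow> real"
  assumes "\<alpha> > 0" and decay: "\<And>k. \<bar>u k\<bar> \<le> C * exp (- \<alpha> * l1_norm k)"
    and x: "x \<in> lattice_cube l"
    and R: "8 * (real CARD('d) + real (mi_size I))\<^sup>2 / \<alpha>\<^sup>2 \<le> R"
    and A: "finite A" "A \<subseteq> - lattice_cube R"
  shows "(\<Sum>k\<in>A. \<bar>real_of_int (mi_power k I) * u (x - k)\<bar>) \<le>
    C * 3 ^ CARD('d) * exp (\<alpha> * l - \<alpha> / 2 * R) / (1 - exp (- \<alpha> / 2))"
proof -
  define q where "q = exp (- \<alpha> / 2)"
  have q: "0 < q" "q < 1" using assms by (auto simp: q_def)
  define D where "D = C * exp (\<alpha> * l)"
  have "0 \<le> C * exp (- \<alpha> * l1_norm (0 :: int ^ 'd))" by (rule order_trans[OF abs_ge_zero decay])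
  hence C: "C \<ge> 0" by (simp add: l1_norm_def)
  hence D: "D \<ge> 0" by (simp add: D_def)
  have R0: "R \<ge> 0" using R by (meson divide_nonneg_nonneg mult_nonneg_nonneg order_trans zero_le_numeral zero_le_power2)
  define B where "B = linf_norm ` A"
  have outside: "real (linf_norm k) > R" if "k \<in> A" for k
    using that A linf_norm_gt_iff by blast
  have summand: "\<bar>real_of_int (mi_power k I) * u (x - k)\<bar> \<le> D * (real (linf_norm k) ^ mi_size I * exp (- \<alpha> * linf_norm k))" for k
  proof -
    have "\<bar>u (x - k)\<bar> \<le> C * exp (- \<alpha> * l1_norm (x - k))" by (rule decay)
    also have "\<dots> \<le> C * exp (- \<alpha> * (real (linf_norm k) - l))"
      using l1_norm_diff_ge[OF x, of k] C \<open>\<alpha> > 0\<close> by (auto intro!: mult_left_mono)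
    also have "\<dots> = D * exp (- \<alpha> * linf_norm k)"
      by (simp add: D_def algebra_simps flip: exp_add)
    finally have "\<bar>u (x - k)\<bar> \<le> D * exp (- \<alpha> * linf_norm k)" .
    moreover have "\<bar>real_of_int (mi_power k I)\<bar> \<le> real (linf_norm k) ^ mi_size I"
      using abs_mi_power_le[of k I] by (metis of_int_abs of_int_le_iff of_int_of_nat_eq of_int_power)
    ultimately have "\<bar>real_of_int (mi_power k I)\<bar> * \<bar>u (x - k)\<bar> \<le> real (linf_norm k) ^ mi_size I * (D * exp (- \<alpha> * linf_norm k))"
      by (intro mult_mono) auto
    thus ?thesis by (simp add: abs_mult mult_ac)
  qed
  have shell: "(\<Sum>k\<in>{k\<in>A. linf_norm k = n}. D * (real (linf_norm k) ^ mi_size I * exp (- \<alpha> * linf_norm k)))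
      \<le> D * 3 ^ CARD('d) * q ^ n" if n: "n \<in> B" for n
  proof -
    \<comment> \<open>From n > R \<ge> 0 follows n \<ge> 1, so 2 n + 1 \<le> 3 n; this is the source
      of the constant 3^d.\<close>
    have nR: "real n > R" using n outside by (auto simp: B_def)
    hence n1: "n \<ge> 1" using R0 by linarith
    have "card {k\<in>A. linf_norm k = n} \<le> card {k::int ^ 'd. linf_norm k \<le> n}"
      by (intro card_mono finite_card_linf_norm_le) auto
    also have "\<dots> \<le> (2 * n + 1) ^ CARD('d)" by (rule finite_card_linf_norm_le)
    also have "\<dots> \<le> (3 * n) ^ CARD('d)" using n1 by (intro power_mono) auto
    finally have "real (card {k\<in>A. linf_norm k = n}) \<le> real ((3 * n) ^ CARD('d))" by (simp only: of_nat_le_iff)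
    hence card: "real (card {k\<in>A. linf_norm k = n}) \<le> 3 ^ CARD('d) * real n ^ CARD('d)"
      by (simp add: power_mult_distrib)
    have "8 * (real (CARD('d) + mi_size I))\<^sup>2 / \<alpha>\<^sup>2 \<le> real n" using R nR by simp
    hence pw: "real n ^ (CARD('d) + mi_size I) \<le> exp (\<alpha> / 2 * real n)"
      by (rule power_le_exp_half[OF \<open>\<alpha> > 0\<close>])
    have "(\<Sum>k\<in>{k\<in>A. linf_norm k = n}. D * (real (linf_norm k) ^ mi_size I * exp (- \<alpha> * linf_norm k)))
        = real (card {k\<in>A. linf_norm k = n}) * (D * (real n ^ mi_size I * exp (- \<alpha> * n)))"
      by simp
    also have "\<dots> \<le> (3 ^ CARD('d) * real n ^ CARD('d)) * (D * (real n ^ mi_size I * exp (- \<alpha> * n)))"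
      using card D by (intro mult_right_mono) auto
    also have "\<dots> = D * 3 ^ CARD('d) * (real n ^ (CARD('d) + mi_size I) * exp (- \<alpha> * n))"
      by (simp add: power_add)
    also have "\<dots> \<le> D * 3 ^ CARD('d) * (exp (\<alpha> / 2 * real n) * exp (- \<alpha> * n))"
      using pw D by (intro mult_left_mono mult_right_mono) auto
    also have "exp (\<alpha> / 2 * real n) * exp (- \<alpha> * n) = q ^ n"
      by (simp add: q_def flip: exp_add exp_of_nat_mult)
    finally show ?thesis .
  qed
  \<comment> \<open>The least integer above \<open>R\<close>: every shell that occurs has index at
    least \<open>n0\<close>, and \<open>n0 \<ge> R\<close> turns \<open>q ^ n0\<close> into a bound
    in terms of \<open>R\<close>.\<close>
  define n0 where "n0 = nat \<lfloor>R\<rfloor> + 1"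
  have n0: "real n0 \<ge> R" using R0 unfolding n0_def by linarith
  have B: "finite B" "B \<subseteq> {n0..}"
  proof -
    show "finite B" using A by (simp add: B_def)
    show "B \<subseteq> {n0..}"
    proof
      fix n assume "n \<in> B"
      hence "real n > R" using outside by (auto simp: B_def)
      thus "n \<in> {n0..}" using R0 unfolding n0_def by simp linarith
    qed
  qed
  have "(\<Sum>k\<in>A. \<bar>real_of_int (mi_power k I) * u (x - k)\<bar>) \<le>
      (\<Sum>k\<in>A. D * (real (linf_norm k) ^ mi_size I * exp (- \<alpha> * linf_norm k)))"
    by (rule sum_mono) (rule summand)
  also have "\<dots> = (\<Sum>n\<in>B. \<Sum>k\<in>{k\<in>A. linf_norm k = n}. D * (real (linf_norm k) ^ mi_size I * exp (- \<alpha> * linf_norm k)))"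
    unfolding B_def by (rule sum.image_gen) (rule A)
  also have "\<dots> \<le> (\<Sum>n\<in>B. D * 3 ^ CARD('d) * q ^ n)"
    by (rule sum_mono) (rule shell)
  also have "\<dots> \<le> D * 3 ^ CARD('d) * (q ^ n0 / (1 - q))"
    unfolding sum_distrib_left[symmetric] using B q D by (intro mult_left_mono sum_geometric_tail_le) auto
  also have "q ^ n0 \<le> exp (- \<alpha> / 2 * R)"
    using n0 \<open>\<alpha> > 0\<close> by (simp add: q_def flip: exp_of_nat_mult)
  hence "D * 3 ^ CARD('d) * (q ^ n0 / (1 - q)) \<le> D * 3 ^ CARD('d) * (exp (- \<alpha> / 2 * R) / (1 - q))"
    using q D by (intro mult_left_mono divide_right_mono) auto
  also have "\<dots> = C * 3 ^ CARD('d) * (exp (\<alpha> * l) * exp (- \<alpha> / 2 * R)) / (1 - q)"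
    by (simp add: D_def)
  also have "exp (\<alpha> * l) * exp (- \<alpha> / 2 * R) = exp (\<alpha> * l - \<alpha> / 2 * R)"
    by (simp flip: exp_add)
  finally show ?thesis by (simp add: q_def)
qed

subsection \<open>The lower bound\<close>

text \<open>The moment result is applied to the coefficients u(-k); translating the summation index
  by \<open>x\<close> moves the shift from the power to \<open>u\<close>.\<close>

lemma gen_fun_has_sum_moment:
  fixes u :: "int ^ 'd::{finite,linorder} \<Rightarrow> real"
  assumes "\<alpha> > 0" and "\<And>k. \<bar>u k\<bar> \<le> C * exp (- \<alpha> * l1_norm k)"
    and "mi_deriv I (gen_fun u) (\<chi> j. 1) = c"
    and "\<And>J. mi_less J I \<Longrightarrow> mi_deriv J (gen_fun u) (\<chi> j. 1) = 0"
  shows "((\<lambda>k. complex_of_real (real_of_int (mi_power k I) * u (x - k))) has_sum c) UNIV"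
proof -
  interpret decaying_family "\<lambda>k. complex_of_real (u (- k))" C \<alpha>
  proof
    show "cmod (complex_of_real (u (- k))) \<le> C * exp (- \<alpha> * l1_norm k)" for k
      using assms(2)[of "- k"] by (simp add: l1_norm_def)
  qed fact
  \<comment> \<open>Both sides are \<open>infsum\<close> of the same family, so they agree at every
    point, even where it is not summable.\<close>
  have "gen_fun u = laurent (\<lambda>_. 0)"
    by (simp add: fun_eq_iff gen_fun_def laurent_def lterm_def mi_powi_def)
  hence "((\<lambda>k. complex_of_real (u (- k)) * of_int (mi_power (x + k) I)) has_sum c) UNIV"
    using shifted_moment_has_sum[of I c x] assms(3,4) by simp
  also have "?this \<longleftrightarrow> ?thesis"
    by (rule has_sum_reindex_bij_witness[of _ "\<lambda>k. k - x" "\<lambda>k. x + k"]) auto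
  finally show ?thesis .
qed

theorem proposition4p2:
  fixes u :: "int ^ 'd::{finite,linorder} \<Rightarrow> real"
    and C \<alpha> l :: real
    and c\<^sub>u :: complex
    and I\<^sub>0 :: "nat ^ 'd::{finite,linorder}"
  assumes "\<exists>k. u k \<noteq> 0"
    and "C > 0" and "\<alpha> > 0"
    and "\<And>k. \<bar>u k\<bar> \<le> C * exp (- \<alpha> * l1_norm k)"
    and "mi_deriv I\<^sub>0 (gen_fun u) (\<chi> j. 1) = c\<^sub>u" and "c\<^sub>u \<noteq> 0"
    and "\<And>I. mi_less I I\<^sub>0 \<Longrightarrow> mi_deriv I (gen_fun u) (\<chi> j. 1) = 0"
    and "l > 0"
  shows "c\<^sub>u \<in> \<real> \<and>
    (\<forall>x \<in> lattice_cube l.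
      2 / Re c\<^sub>u * (\<Sum>k \<in> lattice_cube (cutoff_radius C \<alpha> c\<^sub>u I\<^sub>0 l).
        real_of_int (mi_power k I\<^sub>0) * u (x - k)) \<ge> 1)"
proof -
  define R where "R = cutoff_radius C \<alpha> c\<^sub>u I\<^sub>0 l"
  define f where "f x k = real_of_int (mi_power k I\<^sub>0) * u (x - k)" for x k
  have f: "((\<lambda>k. complex_of_real (f x k)) has_sum c\<^sub>u) UNIV" for x
    unfolding f_def by (rule gen_fun_has_sum_moment) fact+
  \<comment> \<open>The terms are real, so the imaginary part of the sum is a sum of zeros.\<close>
  have "Im c\<^sub>u = 0"
    using has_sum_Im[OF f] by (auto dest: has_sum_unique[OF has_sum_0_simp])
  hence real: "c\<^sub>u = of_real (Re c\<^sub>u)" by (simp add: complex_eq_iff)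
  have c: "Re c\<^sub>u \<noteq> 0" "cmod c\<^sub>u = \<bar>Re c\<^sub>u\<bar>"
    using \<open>c\<^sub>u \<noteq> 0\<close> real by (metis of_real_0, metis norm_of_real)
  define K where "K = 1 - exp (- \<alpha> / 2)"
  \<comment> \<open>The argument of the logarithm in the cutoff radius. The radius forces exp
    (\<alpha> l - \<alpha> R / 2) \<le> 1 / X, and \<open>X\<close> is chosen so that the tail bound
    then equals half of the modulus of the moment.\<close>
  define X where "X = 2 * 3 ^ CARD('d) * C / (cmod c\<^sub>u * K)"
  have K: "K > 0" using \<open>\<alpha> > 0\<close> by (simp add: K_def)
  have X: "X > 0" using K \<open>C > 0\<close> \<open>c\<^sub>u \<noteq> 0\<close> by (simp add: X_def)
  have R: "2 * l + 2 / \<alpha> * ln X \<le> R" "8 * (real CARD('d) + real (mi_size I\<^sub>0))\<^sup>2 / \<alpha>\<^sup>2 \<le> R"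
    by (auto simp: R_def cutoff_radius_def X_def K_def)
  have "\<alpha> / 2 * (2 * l + 2 / \<alpha> * ln X) \<le> \<alpha> / 2 * R"
    using R(1) \<open>\<alpha> > 0\<close> by (intro mult_left_mono) auto
  moreover have "\<alpha> / 2 * (2 * l + 2 / \<alpha> * ln X) = \<alpha> * l + ln X"
    using \<open>\<alpha> > 0\<close> by (simp add: distrib_left)
  ultimately have "\<alpha> * l - \<alpha> / 2 * R \<le> - ln X" by linarith
  hence "exp (\<alpha> * l - \<alpha> / 2 * R) \<le> exp (- ln X)" by simp
  also have "exp (- ln X) = 1 / X" using X by (simp add: exp_minus field_simps)
  finally have "C * 3 ^ CARD('d) * exp (\<alpha> * l - \<alpha> / 2 * R) / K \<le> C * 3 ^ CARD('d) * (1 / X) / K"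
    using K \<open>C > 0\<close> by (intro divide_right_mono mult_left_mono) auto
  also have "\<dots> = cmod c\<^sub>u / 2"
    using K \<open>C > 0\<close> \<open>c\<^sub>u \<noteq> 0\<close> by (simp add: X_def field_simps)
  finally have bound: "C * 3 ^ CARD('d) * exp (\<alpha> * l - \<alpha> / 2 * R) / K \<le> cmod c\<^sub>u / 2" .
  have "2 / Re c\<^sub>u * (\<Sum>k\<in>lattice_cube R. f x k) \<ge> 1" if x: "x \<in> lattice_cube l" for x
  proof -
    define S where "S = (\<Sum>k\<in>lattice_cube R. f x k)"
    have "(f x has_sum Re c\<^sub>u) UNIV" using has_sum_Re[OF f[of x]] by simp
    moreover have "(f x has_sum S) (lattice_cube R)"
      unfolding S_def by (intro has_sum_finite finite_lattice_cube)
    ultimately have out: "(f x has_sum (Re c\<^sub>u - S)) (- lattice_cube R)"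
      unfolding Compl_eq_Diff_UNIV
      by (rule has_sum_Diff) simp
    have fin: "(\<Sum>k\<in>A. \<bar>f x k\<bar>) \<le> cmod c\<^sub>u / 2" if "finite A" "A \<subseteq> - lattice_cube R" for A
      unfolding f_def
      by (rule order_trans[OF sum_outside_cube_le[OF \<open>\<alpha> > 0\<close> assms(4) x R(2) that] bound[unfolded K_def]])
    \<comment> \<open>The bound on finite absolute sums passes to the infinite tail and to its
      negative, giving a two-sided estimate.\<close>
    have "Re c\<^sub>u - S \<le> cmod c\<^sub>u / 2"
    proof (rule has_sum_le_finite_sums[OF out])
      fix A :: "(int ^ 'd::{finite,linorder}) set" assume "finite A" "A \<subseteq> - lattice_cube R"
      have "(\<Sum>k\<in>A. f x k) \<le> (\<Sum>k\<in>A. \<bar>f x k\<bar>)" by (rule sum_mono) auto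
      also have "\<dots> \<le> cmod c\<^sub>u / 2" by (rule fin) fact+
      finally show "(\<Sum>k\<in>A. f x k) \<le> cmod c\<^sub>u / 2" .
    qed
    moreover have "- (Re c\<^sub>u - S) \<le> cmod c\<^sub>u / 2"
    proof (rule has_sum_le_finite_sums[OF has_sum_uminusI[OF out]])
      fix A :: "(int ^ 'd::{finite,linorder}) set" assume "finite A" "A \<subseteq> - lattice_cube R"
      have "(\<Sum>k\<in>A. - f x k) \<le> (\<Sum>k\<in>A. \<bar>f x k\<bar>)" by (rule sum_mono) auto
      also have "\<dots> \<le> cmod c\<^sub>u / 2" by (rule fin) fact+
      finally show "(\<Sum>k\<in>A. - f x k) \<le> cmod c\<^sub>u / 2" .
    qed
    ultimately have "\<bar>Re c\<^sub>u - S\<bar> \<le> \<bar>Re c\<^sub>u\<bar> / 2" using c(2) by linarith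
    \<comment> \<open>S is within half the modulus of the full sum, so it has the same sign and at
      least half the size. Clearing the denominator needs the two signs separately.\<close>
    hence "2 / Re c\<^sub>u * S \<ge> 1"
      using c(1) by (cases "Re c\<^sub>u > 0") (auto simp: field_simps abs_if split: if_splits)
    thus ?thesis by (simp add: S_def)
  qed
  moreover have "c\<^sub>u \<in> \<real>" using real Reals_of_real by metis
  ultimately show ?thesis by (simp add: R_def f_def)
qed

end
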